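(* Let $H\in\mathbb{R}^{m\times m}$ be symmetric positive definite, let $c,u^{\mathrm{nom}}\in\mathbb{R}^m$, and fix the current state $x_t$. Assume that the feasible action set $\mathcal{S}(x_t)\subset\mathbb{R}^m$ (the actions satisfying all safety constraints with zero slack) is nonempty, closed and convex. Suppose the slack penalty $\rho>0$ is sufficiently large that the safety program $$\min_{u,\ \zeta\ge 0}\ \tfrac12(u-u^{\mathrm{nom}})^\top H(u-u^{\mathrm{nom}})+c^\top u+\rho\|\zeta\|_1\quad\text{subject to the safety constraints}$$ is solved with $\zeta=0$. Then its optimizer $u_t^\star$ is unique and satisfies $$u_t^\star=\arg\min_{u\in\mathcal{S}(x_t)}\ \tfrac12\,\big\|u-(u^{\mathrm{nom}}-H^{-1}c)\big\|_H^2,$$ i.e. $u_t^\star$ is the $H$-metric projection of the shifted anchor $u^{\mathrm{nom}}-H^{-1}c$ onto $\mathcal{S}(x_t)$.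
   Context: $\|v\|_H=\sqrt{v^\top Hv}$. The safety constraints, for a fixed state $x_t$ and previous action $u_{t-1}$, on the pair $(u,\zeta)$ are: barrier constraints $h_i(f(x_t)+g(x_t)u)-(1-\kappa_i\Delta t)h_i(x_t)\ge-\zeta_i$ for each $i$ (possibly replaced by surrogates affine in $u$); the no-trade band $e(x_t,u)^\top M e(x_t,u)\le b_{\max}$ with $M\succ0$, where $e(x,u)=b(x,u)-b^\star(x)$ is the difference between the exposure $b(x,u)$ after action $u$ and a target exposure $b^\star(x)$; the box limits $u_{\min}\le u\le u_{\max}$; the rate limit $\|u-u_{t-1}\|_2\le r_{\max}$; and the gate $\min_{j\le J}\langle u,\widehat\nabla\Pi^{(j)}(x_t)\rangle-\delta_{\mathrm{adv}}\ge0$, where the $\widehat\nabla\Pi^{(j)}(x_t)$ are given signal vectors. Only the barrier constraints involve the slack vector $\zeta$. The set $\mathcal{S}(x_t)$ consists of the $u$ for which $(u,0)$ satisfies all these constraints. *)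

theory Defs
  imports "HOL-Analysis.Analysis"
begin

definition sym_pos_def :: "real^'d^'d \<Rightarrow> bool" where
  "sym_pos_def A \<longleftrightarrow> transpose A = A \<and> (\<forall>v. v \<noteq> 0 \<longrightarrow> v \<bullet> (A *v v) > 0)"

definition norm_wrt :: "real^'d^'d \<Rightarrow> real^'d \<Rightarrow> real" where
  "norm_wrt H v = sqrt (v \<bullet> (H *v v))"

definition norm1 :: "real^'d \<Rightarrow> real" where
  "norm1 v = (\<Sum>i\<in>UNIV. \<bar>v $ i\<bar>)"

text \<open>
  Index types: \<open>'n\<close> state coordinates, \<open>'m\<close> action coordinates, \<open>'k\<close> barriers, \<open>'p\<close> exposure
  coordinates, \<open>'j\<close> gate signals. If \<open>surrogate i x = None\<close>, the exact barrier condition number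
  \<open>i\<close> is imposed at state \<open>x\<close>; if it is \<open>Some (a, \<beta>)\<close>, the left-hand side of that condition is
  replaced by the affine function of the action \<open>u\<close> given by \<open>a \<bullet> u + \<beta>\<close>.
\<close>

record ('n::finite, 'm::finite, 'k::finite, 'p::finite, 'j::finite) safety_data =
  drift :: "real^'n \<Rightarrow> real^'n"
  control :: "real^'n \<Rightarrow> real^'m^'n"
  barrier :: "'k \<Rightarrow> real^'n \<Rightarrow> real"
  decay :: "'k \<Rightarrow> real"
  timestep :: real
  surrogate :: "'k \<Rightarrow> real^'n \<Rightarrow> ((real^'m) \<times> real) option"
  exposure :: "real^'n \<Rightarrow> real^'m \<Rightarrow> real^'p"
  target :: "real^'n \<Rightarrow> real^'p"
  band_matrix :: "real^'p^'p"
  band_max :: real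
  u_lower :: "real^'m"
  u_upper :: "real^'m"
  rate_max :: real
  signal :: "'j \<Rightarrow> real^'n \<Rightarrow> real^'m"
  gate_margin :: real

definition barrier_lhs ::
  "('n::finite,'m::finite,'k::finite,'p::finite,'j::finite) safety_data
    \<Rightarrow> real^'n \<Rightarrow> 'k \<Rightarrow> real^'m \<Rightarrow> real" where
  "barrier_lhs D x i u =
    (case surrogate D i x of
       None \<Rightarrow> barrier D i (drift D x + control D x *v u)
                - (1 - decay D i * timestep D) * barrier D i x
     | Some (a, \<beta>) \<Rightarrow> a \<bullet> u + \<beta>)"

definition exposure_error ::
  "('n::finite,'m::finite,'k::finite,'p::finite,'j::finite) safety_data
    \<Rightarrow> real^'n \<Rightarrow> real^'m \<Rightarrow> real^'p" where
  "exposure_error D x u = exposure D x u - target D x"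

text \<open>The order on \<open>real^'m\<close> is componentwise, so the third line is the box constraint.\<close>

definition safety_constraints ::
  "('n::finite,'m::finite,'k::finite,'p::finite,'j::finite) safety_data
    \<Rightarrow> real^'n \<Rightarrow> real^'m \<Rightarrow> real^'m \<Rightarrow> real^'k \<Rightarrow> bool" where
  "safety_constraints D x u_prev u \<zeta> \<longleftrightarrow>
     (\<forall>i. barrier_lhs D x i u \<ge> - (\<zeta> $ i)) \<and>
     exposure_error D x u \<bullet> (band_matrix D *v exposure_error D x u) \<le> band_max D \<and>
     u_lower D \<le> u \<and> u \<le> u_upper D \<and>
     norm (u - u_prev) \<le> rate_max D \<and>
     Min (range (\<lambda>j. u \<bullet> signal D j x)) - gate_margin D \<ge> 0"

definition safe_actions ::
  "('n::finite,'m::finite,'k::finite,'p::finite,'j::finite) safety_data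
    \<Rightarrow> real^'n \<Rightarrow> real^'m \<Rightarrow> (real^'m) set" where
  "safe_actions D x u_prev = {u. safety_constraints D x u_prev u 0}"

definition safety_objective ::
  "real^'m^'m \<Rightarrow> real^'m \<Rightarrow> real^'m \<Rightarrow> real \<Rightarrow> (real^'m) \<times> (real^'k) \<Rightarrow> real" where
  "safety_objective H c u_nom \<rho> = (\<lambda>(u, \<zeta>).
     1/2 * ((u - u_nom) \<bullet> (H *v (u - u_nom))) + c \<bullet> u + \<rho> * norm1 \<zeta>)"

definition safety_program_optimal ::
  "('n::finite,'m::finite,'k::finite,'p::finite,'j::finite) safety_data
    \<Rightarrow> real^'n \<Rightarrow> real^'m \<Rightarrow> real^'m^'m \<Rightarrow> real^'m \<Rightarrow> real^'m \<Rightarrow> real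
    \<Rightarrow> real^'m \<Rightarrow> real^'k \<Rightarrow> bool" where
  "safety_program_optimal D x u_prev H c u_nom \<rho> u \<zeta> \<longleftrightarrow>
     is_arg_min (safety_objective H c u_nom \<rho>)
       (\<lambda>(v, \<xi>). 0 \<le> \<xi> \<and> safety_constraints D x u_prev v \<xi>) (u, \<zeta>)"

definition is_metric_projection ::
  "real^'m^'m \<Rightarrow> (real^'m) set \<Rightarrow> real^'m \<Rightarrow> real^'m \<Rightarrow> bool" where
  "is_metric_projection H S a u \<longleftrightarrow>
     is_arg_min (\<lambda>v. 1/2 * (norm_wrt H (v - a))\<^sup>2) (\<lambda>v. v \<in> S) u"

end

theory Submission
  imports Defs
begin

text \<open>
  Completing the square turns the objective into half the squared \<open>H\<close>-distance to
  the shifted anchor, plus a constant, plus the slack penalty. An optimizer with zero slack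
  therefore minimizes the \<open>H\<close>-distance over the safe set. By the parallelogram identity
  for \<open>H\<close> this minimizer is unique, since the midpoint of two distinct minimizers would be closer.
\<close>

lemma sym_pos_def_inner_commute:
  fixes H :: "real^'d^'d"
  assumes "sym_pos_def H"
  shows "x \<bullet> (H *v y) = y \<bullet> (H *v x)"
proof -
  have "x \<bullet> (H *v y) = (transpose H *v x) \<bullet> y"
    by (metis dot_lmul_matrix transpose_matrix_vector)
  also have "transpose H = H"
    using assms by (simp add: sym_pos_def_def)
  finally show ?thesis
    by (simp only: inner_commute)
qed

lemma sym_pos_def_nonneg:
  assumes "sym_pos_def H"
  shows "0 \<le> v \<bullet> (H *v v)"
  using assms by (cases "v = 0") (auto simp: sym_pos_def_def intro: less_imp_le)

lemma norm_wrt_squared: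
  assumes "sym_pos_def H"
  shows "(norm_wrt H v)\<^sup>2 = v \<bullet> (H *v v)"
  using sym_pos_def_nonneg[OF assms] by (simp add: norm_wrt_def)

text \<open>A kernel vector \<open>v\<close> has \<open>v \<bullet> (H *v v) = 0\<close>, so it
  vanishes; a square matrix with trivial kernel is invertible.\<close>

lemma sym_pos_def_invertible:
  fixes H :: "real^'d^'d"
  assumes "sym_pos_def H"
  shows "invertible H"
proof -
  have "x = 0" if "H *v x = 0" for x
    using assms that by (force simp: sym_pos_def_def)
  then show ?thesis
    using matrix_left_invertible_ker invertible_left_inverse by blast
qed

lemma matrix_inv_mult_vector:
  fixes H :: "real^'d^'d"
  assumes "invertible H"
  shows "H *v (matrix_inv H *v c) = c"
proof -
  have "H ** matrix_inv H = mat 1"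
    \<comment> \<open>\<open>matrix_inv\<close> is a \<open>SOME\<close> choice, so its defining
      property rests on the existence of an inverse.\<close>
    using someI_ex[OF assms[unfolded invertible_def]] by (simp add: matrix_inv_def)
  then show ?thesis
    by (simp add: matrix_vector_mul_assoc)
qed

text \<open>The cross terms of \<open>p + q\<close> and \<open>p - q\<close> cancel. The scaling by
  \<open>1/2\<close> suits midpoints: \<open>p\<close> and \<open>q\<close> will be the
  displacements of two minimizers from the anchor.\<close>

lemma norm_wrt_parallelogram:
  fixes H :: "real^'d^'d"
  assumes "sym_pos_def H"
  shows "(norm_wrt H ((1/2) *\<^sub>R (p + q)))\<^sup>2 + (norm_wrt H (p - q))\<^sup>2 / 4
    = ((norm_wrt H p)\<^sup>2 + (norm_wrt H q)\<^sup>2) / 2"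
  using sym_pos_def_inner_commute[OF assms, of p q]
  by (simp add: norm_wrt_squared[OF assms] matrix_vector_right_distrib
      matrix_vector_mult_diff_distrib matrix_vector_mult_scaleR inner_simps field_simps)

lemma metric_projection_unique:
  fixes H :: "real^'d^'d"
  assumes "sym_pos_def H" and "convex S"
    and "is_metric_projection H S a x" and "is_metric_projection H S a y"
  shows "x = y"
proof (rule ccontr)
  assume "x \<noteq> y"
  let ?F = "\<lambda>v. (norm_wrt H (v - a))\<^sup>2"
  define m where "m = (1/2) *\<^sub>R (x + y)"
  have S: "x \<in> S" "y \<in> S" and min: "\<And>v. v \<in> S \<Longrightarrow> ?F x \<le> ?F v" "\<And>v. v \<in> S \<Longrightarrow> ?F y \<le> ?F v"
    using assms(3,4) by (auto simp: is_metric_projection_def is_arg_min_linorder)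
  have "m \<in> S"
    using convexD[OF assms(2) S, of "1/2" "1/2"] by (simp add: m_def scaleR_add_right)
  have mid: "m - a = (1/2) *\<^sub>R ((x - a) + (y - a))"
    by (simp add: m_def vec_eq_iff field_simps)
  have "(norm_wrt H ((x - a) - (y - a)))\<^sup>2 > 0"
    using assms(1) \<open>x \<noteq> y\<close> by (simp add: norm_wrt_squared sym_pos_def_def)
  \<comment> \<open>The gap is a quarter of the positive quantity just obtained, whereas minimality
    bounds both \<open>?F x\<close> and \<open>?F y\<close> by \<open>?F m\<close>.\<close>
  then have "?F m < (?F x + ?F y) / 2"
    unfolding mid using norm_wrt_parallelogram[OF assms(1), of "x - a" "y - a"] by argo
  with min[OF \<open>m \<in> S\<close>] show False
    by argo
qed

text \<open>With \<open>d\<close> and \<open>w\<close> as in the proof, \<open>H *v d = c\<close>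
  and symmetry make the cross term of the squared norm of \<open>w + d\<close> equal to
  \<open>2 * (c \<bullet> w)\<close>. The constant collects \<open>c \<bullet> u_nom\<close>, from
  \<open>u = w + u_nom\<close>, and the surplus \<open>1/2 * (c \<bullet> d)\<close>.\<close>

lemma safety_objective_complete_square:
  fixes H :: "real^'m^'m"
  assumes "sym_pos_def H"
  shows "safety_objective H c u_nom \<rho> (u, \<zeta>)
    = 1/2 * (norm_wrt H (u - (u_nom - matrix_inv H *v c)))\<^sup>2
      + (c \<bullet> u_nom - 1/2 * (c \<bullet> (matrix_inv H *v c))) + \<rho> * norm1 \<zeta>"
proof -
  define d w where "d = matrix_inv H *v c" and "w = u - u_nom"
  have "H *v d = c"
    using assms by (simp add: d_def matrix_inv_mult_vector sym_pos_def_invertible)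
  moreover have "u - (u_nom - d) = w + d" "u = w + u_nom"
    by (simp_all add: w_def)
  ultimately show ?thesis
    using sym_pos_def_inner_commute[OF assms, of d w]
    unfolding d_def[symmetric]
    by (simp add: safety_objective_def norm_wrt_squared[OF assms] matrix_vector_right_distrib
        inner_simps inner_commute[of c] field_simps)
qed

lemma safety_program_optimal_imp_projection:
  fixes D :: "('n::finite,'m::finite,'k::finite,'p::finite,'j::finite) safety_data"
  assumes "sym_pos_def H"
    and "safety_program_optimal D x u_prev H c u_nom \<rho> u 0"
  shows "is_metric_projection H (safe_actions D x u_prev) (u_nom - matrix_inv H *v c) u"
proof -
  have "u \<in> safe_actions D x u_prev"
    using assms(2) by (simp add: safety_program_optimal_def is_arg_min_def safe_actions_def)
  \<comment> \<open>Each safe \<open>v\<close> yields the feasible competitor \<open>(v, 0)\<close>;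
    at zero slack the objectives differ only in the distance term.\<close>
  moreover have "safety_objective H c u_nom \<rho> (u, 0 :: real^'k)
      \<le> safety_objective H c u_nom \<rho> (v, 0 :: real^'k)" if "v \<in> safe_actions D x u_prev" for v
    using assms(2) that
    by (auto simp: safety_program_optimal_def is_arg_min_linorder safe_actions_def)
  ultimately show ?thesis
    by (simp add: is_metric_projection_def is_arg_min_linorder
        safety_objective_complete_square[OF assms(1)])
qed

text \<open>A sufficiently large penalty is expressed as the existence of an optimizer with zero
  slack. This alone does not exclude ties with nonzero slack, so uniqueness among all pairs is
  stated conditionally.\<close>

theorem proposition1:
  fixes D :: "('n::finite,'m::finite,'k::finite,'p::finite,'j::finite) safety_data"
    and x_t :: "real^'n"
    and u_prev c u_nom :: "real^'m"
    and H :: "real^'m^'m"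
    and \<rho> :: real
  assumes "sym_pos_def H"
    and "sym_pos_def (band_matrix D)"
    and "safe_actions D x_t u_prev \<noteq> {}"
    and "closed (safe_actions D x_t u_prev)"
    and "convex (safe_actions D x_t u_prev)"
    and "\<rho> > 0"
    and "\<exists>u. safety_program_optimal D x_t u_prev H c u_nom \<rho> u 0"
  shows "\<exists>u_star.
    (\<forall>u. safety_program_optimal D x_t u_prev H c u_nom \<rho> u 0 \<longleftrightarrow> u = u_star) \<and>
    (\<forall>u. is_metric_projection H (safe_actions D x_t u_prev)
            (u_nom - matrix_inv H *v c) u \<longleftrightarrow> u = u_star) \<and>
    ((\<forall>u \<zeta>. safety_program_optimal D x_t u_prev H c u_nom \<rho> u \<zeta> \<longrightarrow> \<zeta> = 0) \<longrightarrow>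
      (\<forall>u \<zeta>. safety_program_optimal D x_t u_prev H c u_nom \<rho> u \<zeta> \<longleftrightarrow> u = u_star \<and> \<zeta> = 0))"
proof -
  let ?opt = "safety_program_optimal D x_t u_prev H c u_nom \<rho>"
  let ?proj = "is_metric_projection H (safe_actions D x_t u_prev) (u_nom - matrix_inv H *v c)"
  obtain u_star where star: "?opt u_star 0"
    using assms(7) by blast
  have proj: "?proj u" if "?opt u 0" for u
    using safety_program_optimal_imp_projection[OF assms(1) that] .
  have uniq: "u = u_star" if "?proj u" for u
    using metric_projection_unique[OF assms(1,5) that proj[OF star]] .
  show ?thesis
    using star proj uniq by (intro exI[of _ u_star]) blast
qed

end
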